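(* Let $L$ be a finite-dimensional (right) Leibniz algebra over a field of characteristic zero. If $L$ is almost algebraic, then the Lie algebra $R(L)$ is almost algebraic.
   Context: A (right) Leibniz algebra over a field $F$ is an $F$-vector space with a bilinear product $[\cdot,\cdot]$ satisfying $[x,[y,z]]=[[x,y],z]-[[x,z],y]$ for all $x,y,z$. The Leibniz kernel of $L$ is $I=\mathrm{span}\{x^2: x\in L\}$ with $x^2=[x,x]$; it is an ideal and $L/I$ is a Lie algebra. For $x\in L$, $R_x:L\to L$ is $y\mapsto [y,x]$. The inner derivation algebra of $L$ is $R(L)=\{R_x\mid x\in L\}$, a Lie algebra under the commutator bracket $[R_x,R_y]=R_xR_y-R_yR_x=R_{[y,x]}$. Almost algebraic: a linear Lie algebra $\mathfrak g\leq \mathrm{gl}(V)$ is almost algebraic if it contains the semisimple and nilpotent Jordan components of each of its elements; an abstract Lie algebra $\mathfrak g$ is almost algebraic if $\mathrm{ad}\,\mathfrak g\leq \mathrm{gl}(\mathfrak g)$ is almost algebraic; a Leibniz algebra $L$ is almost algebraic if the Lie algebra $L/I$ is almost algebraic. Here $R(L)$ is regarded as an abstract Lie algebra. *)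

theory Defs
  imports "HOL-Algebra.Module" "HOL-Algebra.QuotRing"
begin

text \<open>
  Non-associative algebras over a field \<open>K\<close> are represented by the records of
  \<^theory>\<open>HOL-Algebra.Module\<close>: the vector space structure is given by \<open>\<oplus>\<close>, \<open>\<zero>\<close>, \<open>\<odot>\<close>,
  and the bracket \<open>[x, y]\<close> is the record field written \<open>x \<otimes> y\<close>.  The record field \<open>one\<close>
  plays no role and is left undefined in the constructions below.
\<close>

section \<open>Leibniz and Lie algebras\<close>

locale nonassoc_algebra = K?: field K + module K L for K and L (structure) +
  assumes mult_closed [simp, intro]:
      "\<lbrakk>x \<in> carrier L; y \<in> carrier L\<rbrakk> \<Longrightarrow> x \<otimes> y \<in> carrier L"
    and add_mult:
      "\<lbrakk>x \<in> carrier L; y \<in> carrier L; z \<in> carrier L\<rbrakk> \<Longrightarrow> (x \<oplus> y) \<otimes> z = x \<otimes> z \<oplus> y \<otimes> z"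
    and mult_add:
      "\<lbrakk>x \<in> carrier L; y \<in> carrier L; z \<in> carrier L\<rbrakk> \<Longrightarrow> x \<otimes> (y \<oplus> z) = x \<otimes> y \<oplus> x \<otimes> z"
    and smult_mult:
      "\<lbrakk>a \<in> carrier K; x \<in> carrier L; y \<in> carrier L\<rbrakk> \<Longrightarrow> (a \<odot> x) \<otimes> y = a \<odot> (x \<otimes> y)"
    and mult_smult:
      "\<lbrakk>a \<in> carrier K; x \<in> carrier L; y \<in> carrier L\<rbrakk> \<Longrightarrow> x \<otimes> (a \<odot> y) = a \<odot> (x \<otimes> y)"

locale leibniz_algebra = nonassoc_algebra +
  assumes leibniz_identity:
    "\<lbrakk>x \<in> carrier L; y \<in> carrier L; z \<in> carrier L\<rbrakk>
      \<Longrightarrow> x \<otimes> (y \<otimes> z) = (x \<otimes> y) \<otimes> z \<ominus> (x \<otimes> z) \<otimes> y"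

locale lie_algebra = nonassoc_algebra +
  assumes alternating: "x \<in> carrier L \<Longrightarrow> x \<otimes> x = \<zero>"
    and jacobi_identity:
      "\<lbrakk>x \<in> carrier L; y \<in> carrier L; z \<in> carrier L\<rbrakk>
        \<Longrightarrow> x \<otimes> (y \<otimes> z) \<oplus> y \<otimes> (z \<otimes> x) \<oplus> z \<otimes> (x \<otimes> y) = \<zero>"

definition char_zero :: "('a, 'm) ring_scheme \<Rightarrow> bool" where
  "char_zero K \<longleftrightarrow> (\<forall>n::nat. 0 < n \<longrightarrow> [n] \<cdot>\<^bsub>K\<^esub> \<one>\<^bsub>K\<^esub> \<noteq> \<zero>\<^bsub>K\<^esub>)"

definition lin_span :: "('a, 'm) ring_scheme \<Rightarrow> ('a, 'b, 'n) module_scheme \<Rightarrow> 'b set \<Rightarrow> 'b set" where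
  "lin_span K V A = \<Inter>{H. submodule H K V \<and> A \<subseteq> H}"

definition fin_dim :: "('a, 'm) ring_scheme \<Rightarrow> ('a, 'b, 'n) module_scheme \<Rightarrow> bool" where
  "fin_dim K V \<longleftrightarrow> (\<exists>B. finite B \<and> B \<subseteq> carrier V \<and> lin_span K V B = carrier V)"

section \<open>The Leibniz kernel and its quotient\<close>

definition leibniz_kernel ::
    "('a, 'm) ring_scheme \<Rightarrow> ('a, 'b, 'n) module_scheme \<Rightarrow> 'b set" where
  "leibniz_kernel K L = lin_span K L ((\<lambda>x. x \<otimes>\<^bsub>L\<^esub> x) ` carrier L)"

text \<open>
  Apart from the scalar multiplication this is the ring quotient \<^const>\<open>FactRing\<close>.  The unions
  are the cosets of the product (scalar multiple) of representatives whenever \<open>I\<close> is an ideal.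
\<close>

definition quot_algebra ::
    "('a, 'b, 'n) module_scheme \<Rightarrow> 'b set \<Rightarrow> ('a, 'b set) module" where
  "quot_algebra L I =
    \<lparr>carrier = a_rcosets\<^bsub>L\<^esub> I, mult = rcoset_mult L I, one = undefined,
     zero = I, add = set_add L,
     smult = (\<lambda>a C. \<Union>x\<in>C. I +>\<^bsub>L\<^esub> (a \<odot>\<^bsub>L\<^esub> x))\<rparr>"

section \<open>The general linear Lie algebra\<close>

text \<open>
  Endomorphisms are extensional functions, so that equality in \<open>gl V\<close> is equality as maps on
  the carrier of \<open>V\<close>.
\<close>

definition lin_endos ::
    "('a, 'm) ring_scheme \<Rightarrow> ('a, 'b, 'n) module_scheme \<Rightarrow> ('b \<Rightarrow> 'b) set" where
  "lin_endos K V =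
    {T \<in> carrier V \<rightarrow>\<^sub>E carrier V.
      (\<forall>x\<in>carrier V. \<forall>y\<in>carrier V. T (x \<oplus>\<^bsub>V\<^esub> y) = T x \<oplus>\<^bsub>V\<^esub> T y) \<and>
      (\<forall>a\<in>carrier K. \<forall>x\<in>carrier V. T (a \<odot>\<^bsub>V\<^esub> x) = a \<odot>\<^bsub>V\<^esub> T x)}"

definition gl :: "('a, 'm) ring_scheme \<Rightarrow> ('a, 'b, 'n) module_scheme \<Rightarrow> ('a, 'b \<Rightarrow> 'b) module" where
  "gl K V =
    \<lparr>carrier = lin_endos K V,
     mult = (\<lambda>S T. \<lambda>x\<in>carrier V. S (T x) \<ominus>\<^bsub>V\<^esub> T (S x)), one = undefined,
     zero = (\<lambda>x\<in>carrier V. \<zero>\<^bsub>V\<^esub>), add = (\<lambda>S T. \<lambda>x\<in>carrier V. S x \<oplus>\<^bsub>V\<^esub> T x),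
     smult = (\<lambda>a T. \<lambda>x\<in>carrier V. a \<odot>\<^bsub>V\<^esub> T x)\<rparr>"

definition right_mult :: "('a, 'b, 'n) module_scheme \<Rightarrow> 'b \<Rightarrow> 'b \<Rightarrow> 'b" where
  "right_mult L x = (\<lambda>y\<in>carrier L. y \<otimes>\<^bsub>L\<^esub> x)"

definition inner_derivations ::
    "('a, 'm) ring_scheme \<Rightarrow> ('a, 'b, 'n) module_scheme \<Rightarrow> ('a, 'b \<Rightarrow> 'b) module" where
  "inner_derivations K L = (gl K L)\<lparr>carrier := right_mult L ` carrier L\<rparr>"

definition ad :: "('a, 'b, 'n) module_scheme \<Rightarrow> 'b \<Rightarrow> 'b \<Rightarrow> 'b" where
  "ad g x = (\<lambda>y\<in>carrier g. x \<otimes>\<^bsub>g\<^esub> y)"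

section \<open>Jordan decomposition and almost algebraic algebras\<close>

definition invariant_subspace ::
    "('a, 'm) ring_scheme \<Rightarrow> ('a, 'b, 'n) module_scheme \<Rightarrow> ('b \<Rightarrow> 'b) \<Rightarrow> 'b set \<Rightarrow> bool" where
  "invariant_subspace K V T W \<longleftrightarrow> submodule W K V \<and> T ` W \<subseteq> W"

text \<open>
  Semisimplicity is complete reducibility; over a perfect field this is diagonalisability over
  the algebraic closure.
\<close>

definition semisimple_endo ::
    "('a, 'm) ring_scheme \<Rightarrow> ('a, 'b, 'n) module_scheme \<Rightarrow> ('b \<Rightarrow> 'b) \<Rightarrow> bool" where
  "semisimple_endo K V T \<longleftrightarrow> T \<in> lin_endos K V \<and>
    (\<forall>W. invariant_subspace K V T W \<longrightarrow>
      (\<exists>U. invariant_subspace K V T U \<and> W \<inter> U = {\<zero>\<^bsub>V\<^esub>} \<and> W <+>\<^bsub>V\<^esub> U = carrier V))"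

definition nilpotent_endo ::
    "('a, 'm) ring_scheme \<Rightarrow> ('a, 'b, 'n) module_scheme \<Rightarrow> ('b \<Rightarrow> 'b) \<Rightarrow> bool" where
  "nilpotent_endo K V T \<longleftrightarrow> T \<in> lin_endos K V \<and>
    (\<exists>n. \<forall>x\<in>carrier V. (T ^^ n) x = \<zero>\<^bsub>V\<^esub>)"

definition jordan_decomposition ::
    "('a, 'm) ring_scheme \<Rightarrow> ('a, 'b, 'n) module_scheme \<Rightarrow>
      ('b \<Rightarrow> 'b) \<Rightarrow> ('b \<Rightarrow> 'b) \<Rightarrow> ('b \<Rightarrow> 'b) \<Rightarrow> bool" where
  "jordan_decomposition K V T S N \<longleftrightarrow>
    semisimple_endo K V S \<and> nilpotent_endo K V N \<and>
    T = S \<oplus>\<^bsub>gl K V\<^esub> N \<and> (\<forall>x\<in>carrier V. S (N x) = N (S x))"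

text \<open>
  In finite dimension over a field of characteristic zero every endomorphism has exactly one
  Jordan decomposition, so the existential quantifier speaks about the semisimple and the
  nilpotent component of \<open>T\<close>.
\<close>

definition almost_algebraic_linear ::
    "('a, 'm) ring_scheme \<Rightarrow> ('a, 'b, 'n) module_scheme \<Rightarrow> ('b \<Rightarrow> 'b) set \<Rightarrow> bool" where
  "almost_algebraic_linear K V G \<longleftrightarrow>
    (\<forall>T\<in>G. \<exists>S N. jordan_decomposition K V T S N \<and> S \<in> G \<and> N \<in> G)"

definition almost_algebraic_lie ::
    "('a, 'm) ring_scheme \<Rightarrow> ('a, 'b, 'n) module_scheme \<Rightarrow> bool" where
  "almost_algebraic_lie K g \<longleftrightarrow> almost_algebraic_linear K g (ad g ` carrier g)"

definition almost_algebraic_leibniz ::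
    "('a, 'm) ring_scheme \<Rightarrow> ('a, 'b, 'n) module_scheme \<Rightarrow> bool" where
  "almost_algebraic_leibniz K L \<longleftrightarrow>
    almost_algebraic_lie K (quot_algebra L (leibniz_kernel K L))"

section \<open>\<open>L / I\<close> and \<open>R(L)\<close> are Lie algebras\<close>

context nonassoc_algebra
begin

lemma lin_span_submodule:
  assumes "A \<subseteq> carrier L"
  shows "submodule (lin_span K L A) K L"
proof -
  have c: "submodule (carrier L) K L" by (rule carrier_is_submodule)
  show ?thesis unfolding lin_span_def
    by (rule submoduleI) (use assms c in \<open>auto simp: submoduleE(3,4,5) dest: submoduleE(1)
        intro: subgroup.one_closed[OF submodule.axioms(1), simplified]\<close>)
qed

lemma lin_span_superset: "A \<subseteq> lin_span K L A"
  by (auto simp: lin_span_def)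

lemma lin_span_least: "submodule H K L \<Longrightarrow> A \<subseteq> H \<Longrightarrow> lin_span K L A \<subseteq> H"
  by (auto simp: lin_span_def)

lemma mult_zero [simp]: "x \<in> carrier L \<Longrightarrow> x \<otimes> \<zero> = \<zero>"
  using mult_smult[of "\<zero>\<^bsub>K\<^esub>" x \<zero>] by simp

lemma zero_mult [simp]: "x \<in> carrier L \<Longrightarrow> \<zero> \<otimes> x = \<zero>"
  using smult_mult[of "\<zero>\<^bsub>K\<^esub>" \<zero> x] by simp

lemma minus_conv_smult: "x \<in> carrier L \<Longrightarrow> \<ominus> x = (\<ominus>\<^bsub>K\<^esub> \<one>\<^bsub>K\<^esub>) \<odot> x"
  by (simp add: smult_l_minus)

lemma mult_minus: "x \<in> carrier L \<Longrightarrow> y \<in> carrier L \<Longrightarrow> x \<otimes> (\<ominus> y) = \<ominus> (x \<otimes> y)"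
  by (simp add: minus_conv_smult mult_smult)

lemma minus_mult: "x \<in> carrier L \<Longrightarrow> y \<in> carrier L \<Longrightarrow> (\<ominus> x) \<otimes> y = \<ominus> (x \<otimes> y)"
  by (simp add: minus_conv_smult smult_mult)

end

lemma nonassoc_algebra_surj_image:
  fixes K (structure) and L (structure)
  assumes "nonassoc_algebra K L"
    and im: "carrier Q = f ` carrier L"
    and add: "\<And>x y. x \<in> carrier L \<Longrightarrow> y \<in> carrier L \<Longrightarrow> f x \<oplus>\<^bsub>Q\<^esub> f y = f (x \<oplus>\<^bsub>L\<^esub> y)"
    and mult: "\<And>x y. x \<in> carrier L \<Longrightarrow> y \<in> carrier L \<Longrightarrow> f x \<otimes>\<^bsub>Q\<^esub> f y = f (x \<otimes>\<^bsub>L\<^esub> y)"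
    and smult: "\<And>a x. a \<in> carrier K \<Longrightarrow> x \<in> carrier L \<Longrightarrow> a \<odot>\<^bsub>Q\<^esub> f x = f (a \<odot>\<^bsub>L\<^esub> x)"
    and zero: "f \<zero>\<^bsub>L\<^esub> = \<zero>\<^bsub>Q\<^esub>"
  shows "nonassoc_algebra K Q"
proof -
  interpret L: nonassoc_algebra K L by fact
  have ag: "abelian_group Q"
  proof (rule abelian_groupI)
    show "\<exists>y\<in>carrier Q. y \<oplus>\<^bsub>Q\<^esub> x = \<zero>\<^bsub>Q\<^esub>" if xQ: "x \<in> carrier Q" for x
    proof -
      obtain z where z: "z \<in> carrier L" "x = f z" using xQ im by auto
      then show ?thesis using im by (intro bexI[of _ "f (\<ominus>\<^bsub>L\<^esub> z)"]) (auto simp: add L.M.l_neg zero)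
    qed
  qed (auto simp: im add L.M.a_ac zero[symmetric])
  interpret Q: module K Q
    by (rule moduleI[OF module.axioms(1)[OF L.module_axioms] ag])
       (auto simp: im add smult L.smult_l_distr L.smult_r_distr L.smult_assoc1)
  show ?thesis
    by unfold_locales
       (auto simp: im add smult mult L.add_mult L.mult_add L.smult_mult L.mult_smult)
qed

lemma (in leibniz_algebra) lie_algebraI:
  assumes "\<And>x. x \<in> carrier L \<Longrightarrow> x \<otimes> x = \<zero>"
  shows "lie_algebra K L"
proof unfold_locales
  have anti: "x \<otimes> y = \<ominus> (y \<otimes> x)" if "x \<in> carrier L" "y \<in> carrier L" for x y
  proof -
    have "(x \<oplus> y) \<otimes> (x \<oplus> y) = x \<otimes> y \<oplus> y \<otimes> x"
      using that assms[OF that(1)] assms[OF that(2)] by (simp add: add_mult mult_add M.a_comm)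
    then have "x \<otimes> y \<oplus> y \<otimes> x = \<zero>" using assms that by (metis M.add.m_closed)
    then show ?thesis using that M.minus_equality by simp
  qed
  fix x y z assume c: "x \<in> carrier L" "y \<in> carrier L" "z \<in> carrier L"
  have "x \<otimes> (y \<otimes> z) = (x \<otimes> y) \<otimes> z \<ominus> (x \<otimes> z) \<otimes> y" using c by (rule leibniz_identity)
  also have "(x \<otimes> y) \<otimes> z = \<ominus> (z \<otimes> (x \<otimes> y))" by (rule anti) (use c in auto)
  also have "(x \<otimes> z) \<otimes> y = y \<otimes> (z \<otimes> x)"
    using c anti[of "x \<otimes> z" y] anti[of x z] by (simp add: mult_minus)
  finally show "x \<otimes> (y \<otimes> z) \<oplus> y \<otimes> (z \<otimes> x) \<oplus> z \<otimes> (x \<otimes> y) = \<zero>"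
    using c by (simp add: M.minus_eq M.a_ac M.r_neg M.l_neg M.r_neg2 M.r_neg1)
qed (use assms in auto)

context leibniz_algebra
begin

lemma squares_subset: "(\<lambda>x. x \<otimes> x) ` carrier L \<subseteq> carrier L" by auto

lemma leibniz_kernel_submodule: "submodule (leibniz_kernel K L) K L"
  unfolding leibniz_kernel_def by (rule lin_span_submodule[OF squares_subset])

lemma square_in_leibniz_kernel: "x \<in> carrier L \<Longrightarrow> x \<otimes> x \<in> leibniz_kernel K L"
  unfolding leibniz_kernel_def by (rule subsetD[OF lin_span_superset]) simp

lemma mult_square: "z \<in> carrier L \<Longrightarrow> x \<in> carrier L \<Longrightarrow> z \<otimes> (x \<otimes> x) = \<zero>"
  by (simp add: leibniz_identity M.minus_eq M.r_neg)

lemma mult_leibniz_kernel: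
  assumes "z \<in> carrier L" "i \<in> leibniz_kernel K L"
  shows "z \<otimes> i = \<zero>"
proof -
  have "submodule {w \<in> carrier L. z \<otimes> w = \<zero>} K L"
    by (rule submoduleI) (use assms(1) in \<open>auto simp: mult_minus mult_add mult_smult\<close>)
  then have "leibniz_kernel K L \<subseteq> {w \<in> carrier L. z \<otimes> w = \<zero>}"
    unfolding leibniz_kernel_def
    by (rule lin_span_least) (use assms(1) mult_square in auto)
  with assms show ?thesis by auto
qed

lemma leibniz_kernel_mult:
  assumes z: "z \<in> carrier L" and "i \<in> leibniz_kernel K L"
  shows "i \<otimes> z \<in> leibniz_kernel K L"
proof -
  let ?I = "leibniz_kernel K L"
  note I = submoduleE[OF leibniz_kernel_submodule]
  have sq: "(x \<otimes> x) \<otimes> z \<in> ?I" if x: "x \<in> carrier L" for x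
  proof -
    have "(x \<otimes> x \<oplus> z) \<otimes> (x \<otimes> x \<oplus> z) = (x \<otimes> x) \<otimes> z \<oplus> z \<otimes> z"
      using x z by (simp add: add_mult mult_add mult_square)
    then have "(x \<otimes> x) \<otimes> z = (x \<otimes> x \<oplus> z) \<otimes> (x \<otimes> x \<oplus> z) \<oplus> \<ominus> (z \<otimes> z)"
      using x z by (simp add: M.a_assoc M.r_neg)
    moreover have "\<dots> \<in> ?I"
      using x z by (intro I(5) I(3) square_in_leibniz_kernel) auto
    ultimately show ?thesis by simp
  qed
  have "\<zero> \<in> ?I" using mult_square[of \<zero> \<zero>] square_in_leibniz_kernel[of \<zero>] by simp
  then have "submodule {w \<in> carrier L. w \<otimes> z \<in> ?I} K L"
    by (intro submoduleI) (use z I in \<open>auto simp: minus_mult add_mult smult_mult\<close>)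
  then have "?I \<subseteq> {w \<in> carrier L. w \<otimes> z \<in> ?I}"
    using sq unfolding leibniz_kernel_def
    by (intro lin_span_least) auto
  with assms show ?thesis by auto
qed

theorem lie_algebra_quot: "lie_algebra K (quot_algebra L (leibniz_kernel K L))"
proof -
  let ?I = "leibniz_kernel K L"
  let ?Q = "quot_algebra L ?I"
  define f where "f x = ?I +> x" for x
  note I = submoduleE[OF leibniz_kernel_submodule]
  have z: "\<zero> \<in> ?I" using mult_square[of \<zero> \<zero>] square_in_leibniz_kernel[of \<zero>] by simp
  interpret I: abelian_subgroup ?I L
    by (rule abelian_subgroupI3)
       (use leibniz_kernel_submodule M.abelian_group_axioms
         in \<open>auto simp: additive_subgroup_def submodule_def\<close>)
  have im: "carrier ?Q = f ` carrier L"
    unfolding f_def by (auto simp: quot_algebra_def A_RCOSETS_defs a_r_coset_def r_coset_def)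
  have coset: "y \<in> f x \<longleftrightarrow> (\<exists>i\<in>?I. y = i \<oplus> x)" for x y
    by (auto simp: f_def a_r_coset_def r_coset_def)
  have eqI: "f (i \<oplus> x) = f x" if "i \<in> ?I" "x \<in> carrier L" for i x
    using that unfolding f_def
    by (metis I.a_repr_independence' coset f_def)
  have add: "f x \<oplus>\<^bsub>?Q\<^esub> f y = f (x \<oplus> y)" if "x \<in> carrier L" "y \<in> carrier L" for x y
    using that by (simp add: quot_algebra_def f_def I.a_rcos_sum)
  have self: "x \<in> f x" if "x \<in> carrier L" for x
    using that unfolding f_def by (rule I.a_rcos_self)
  have mult: "f x \<otimes>\<^bsub>?Q\<^esub> f y = f (x \<otimes> y)" if c: "x \<in> carrier L" "y \<in> carrier L" for x y
  proof -
    have "f (a \<otimes> b) = f (x \<otimes> y)" if ab: "a \<in> f x" "b \<in> f y" for a b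
    proof -
      obtain i j where ij: "i \<in> ?I" "j \<in> ?I" "a = i \<oplus> x" "b = j \<oplus> y" using ab[unfolded coset] by blast
      then have "i \<in> carrier L" "j \<in> carrier L" using I(1) by auto
      then have "a \<otimes> b = i \<otimes> y \<oplus> x \<otimes> y"
        using c ij by (simp add: add_mult mult_add mult_leibniz_kernel)
      then show ?thesis using eqI leibniz_kernel_mult ij c by simp
    qed
    then have "(\<Union>a\<in>f x. \<Union>b\<in>f y. f (a \<otimes> b)) = (\<Union>a\<in>f x. \<Union>b\<in>f y. f (x \<otimes> y))"
      by (intro SUP_cong refl)
    also have "\<dots> = f (x \<otimes> y)" using self[OF c(1)] self[OF c(2)] by (metis SUP_const empty_iff)
    finally have "(\<Union>a\<in>f x. \<Union>b\<in>f y. f (a \<otimes> b)) = f (x \<otimes> y)" .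
    then show ?thesis by (simp add: quot_algebra_def rcoset_mult_def f_def)
  qed
  have smult: "a \<odot>\<^bsub>?Q\<^esub> f x = f (a \<odot> x)" if c: "a \<in> carrier K" "x \<in> carrier L" for a x
  proof -
    have "f (a \<odot> b) = f (a \<odot> x)" if b: "b \<in> f x" for b
    proof -
      obtain i where i: "i \<in> ?I" "b = i \<oplus> x" using b[unfolded coset] by blast
      then have "i \<in> carrier L" using I(1) by auto
      then show ?thesis using c i eqI I(4) by (simp add: smult_r_distr)
    qed
    then have "(\<Union>b\<in>f x. f (a \<odot> b)) = (\<Union>b\<in>f x. f (a \<odot> x))"
      by (intro SUP_cong refl)
    also have "\<dots> = f (a \<odot> x)" using self[OF c(2)] by (metis SUP_const empty_iff)
    finally have "(\<Union>b\<in>f x. f (a \<odot> b)) = f (a \<odot> x)" .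
    then show ?thesis by (simp add: quot_algebra_def f_def)
  qed
  have zero: "f \<zero> = \<zero>\<^bsub>?Q\<^esub>"
    unfolding f_def using z I.a_rcos_const by (simp add: quot_algebra_def)
  interpret Q: nonassoc_algebra K ?Q
    by (rule nonassoc_algebra_surj_image[OF nonassoc_algebra_axioms im add mult smult zero])
  have minus: "\<ominus>\<^bsub>?Q\<^esub> f x = f (\<ominus> x)" if "x \<in> carrier L" for x
    using that smult[of "\<ominus>\<^bsub>K\<^esub> \<one>\<^bsub>K\<^esub>" x] im by (subst Q.minus_conv_smult) (auto simp: minus_conv_smult)
  have "leibniz_algebra K ?Q"
  proof unfold_locales
    fix X Y Z assume "X \<in> carrier ?Q" "Y \<in> carrier ?Q" "Z \<in> carrier ?Q"
    then obtain x y z where c: "x \<in> carrier L" "y \<in> carrier L" "z \<in> carrier L"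
      and X: "X = f x" "Y = f y" "Z = f z" unfolding im by blast
    show "X \<otimes>\<^bsub>?Q\<^esub> (Y \<otimes>\<^bsub>?Q\<^esub> Z)
      = X \<otimes>\<^bsub>?Q\<^esub> Y \<otimes>\<^bsub>?Q\<^esub> Z \<ominus>\<^bsub>?Q\<^esub> X \<otimes>\<^bsub>?Q\<^esub> Z \<otimes>\<^bsub>?Q\<^esub> Y"
      unfolding X Q.M.minus_eq
      using c leibniz_identity[OF c] by (simp only: mult add minus mult_closed M.a_inv_closed M.minus_eq)
  qed
  then show ?thesis
  proof (rule leibniz_algebra.lie_algebraI)
    fix X assume "X \<in> carrier ?Q"
    then obtain x where x: "x \<in> carrier L" "X = f x" unfolding im by blast
    then have "X \<otimes>\<^bsub>?Q\<^esub> X = f (x \<otimes> x)" using mult by blast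
    also have "\<dots> = ?I" unfolding f_def by (rule I.a_rcos_const[OF square_in_leibniz_kernel[OF x(1)]])
    finally show "X \<otimes>\<^bsub>?Q\<^esub> X = \<zero>\<^bsub>?Q\<^esub>" by (simp add: quot_algebra_def)
  qed
qed

lemma right_mult_in_lin_endos: "x \<in> carrier L \<Longrightarrow> right_mult L x \<in> lin_endos K L"
  by (auto simp: right_mult_def lin_endos_def add_mult smult_mult)

lemma bracket_right_mult:
  assumes "x \<in> carrier L" "y \<in> carrier L"
  shows "right_mult L x \<otimes>\<^bsub>gl K L\<^esub> right_mult L y = right_mult L (y \<otimes> x)"
  using assms by (auto simp: gl_def right_mult_def leibniz_identity fun_eq_iff restrict_def)

theorem lie_algebra_inner_derivations: "lie_algebra K (inner_derivations K L)"
proof -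
  let ?Q = "inner_derivations K L"
  let ?f = "right_mult L"
  define L' where "L' = L\<lparr>mult := \<lambda>x y. y \<otimes> x\<rparr>"
  have L': "carrier L' = carrier L" "add L' = add L" "smult L' = smult L" "zero L' = zero L"
    "x \<otimes>\<^bsub>L'\<^esub> y = y \<otimes> x" for x y by (simp_all add: L'_def)
  have ag: "abelian_group L'"
    by (rule abelian_groupI) (use M.l_neg in \<open>auto simp: L' M.a_ac\<close>)
  interpret L': module K L'
    by (rule moduleI[OF module.axioms(1)[OF module_axioms] ag])
       (auto simp: L' smult_l_distr smult_r_distr smult_assoc1)
  interpret L': nonassoc_algebra K L'
    by unfold_locales (auto simp: L' add_mult mult_add smult_mult mult_smult)
  have mult: "?f x \<otimes>\<^bsub>?Q\<^esub> ?f y = ?f (y \<otimes> x)" if "x \<in> carrier L" "y \<in> carrier L" for x y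
    using bracket_right_mult[OF that] by (simp add: inner_derivations_def)
  have zero: "?f \<zero> = \<zero>\<^bsub>?Q\<^esub>"
    by (auto simp: inner_derivations_def gl_def right_mult_def)
  interpret Q: nonassoc_algebra K ?Q
    by (rule nonassoc_algebra_surj_image[OF L'.nonassoc_algebra_axioms, where f = ?f])
       (use mult zero in \<open>auto simp: L' inner_derivations_def gl_def right_mult_def
          mult_add mult_smult fun_eq_iff restrict_def\<close>)
  have car: "carrier ?Q = ?f ` carrier L" by (simp add: inner_derivations_def)
  have alt: "X \<otimes>\<^bsub>?Q\<^esub> X = \<zero>\<^bsub>?Q\<^esub>" if XQ: "X \<in> carrier ?Q" for X
  proof -
    obtain x where x: "x \<in> carrier L" "X = ?f x" using XQ unfolding car by blast
    then have "X \<otimes>\<^bsub>?Q\<^esub> X = ?f (x \<otimes> x)" using mult by blast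
    also have "\<dots> = ?f \<zero>" using x(1) by (auto simp: right_mult_def mult_square)
    finally show ?thesis using zero by simp
  qed
  have add: "?f x \<oplus>\<^bsub>?Q\<^esub> ?f y = ?f (x \<oplus> y)" if "x \<in> carrier L" "y \<in> carrier L" for x y
    using that by (auto simp: inner_derivations_def gl_def right_mult_def mult_add fun_eq_iff)
  have smult: "a \<odot>\<^bsub>?Q\<^esub> ?f x = ?f (a \<odot> x)" if "a \<in> carrier K" "x \<in> carrier L" for a x
    using that by (auto simp: inner_derivations_def gl_def right_mult_def mult_smult fun_eq_iff)
  have minus: "\<ominus>\<^bsub>?Q\<^esub> ?f x = ?f (\<ominus> x)" if "x \<in> carrier L" for x
    using that smult[of "\<ominus>\<^bsub>K\<^esub> \<one>\<^bsub>K\<^esub>" x] car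
    by (subst Q.minus_conv_smult) (auto simp: minus_conv_smult)
  have rel: "?f ((z \<otimes> y) \<otimes> x) = ?f (z \<otimes> (y \<otimes> x) \<oplus> \<ominus> (y \<otimes> (z \<otimes> x)))"
    if c: "x \<in> carrier L" "y \<in> carrier L" "z \<in> carrier L" for x y z
  proof -
    have "u \<otimes> ((z \<otimes> y) \<otimes> x) = u \<otimes> (z \<otimes> (y \<otimes> x) \<oplus> \<ominus> (y \<otimes> (z \<otimes> x)))"
      if u: "u \<in> carrier L" for u
    proof -
      have s: "u \<otimes> (a \<otimes> b) = \<ominus> (u \<otimes> (b \<otimes> a))" if "a \<in> carrier L" "b \<in> carrier L" for a b
        using that u by (simp add: leibniz_identity M.minus_eq M.minus_add M.a_ac)
      have "z \<otimes> (y \<otimes> x) = (z \<otimes> y) \<otimes> x \<oplus> \<ominus> ((z \<otimes> x) \<otimes> y)"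
        using c by (simp add: leibniz_identity M.minus_eq)
      then have "u \<otimes> (z \<otimes> (y \<otimes> x) \<oplus> \<ominus> (y \<otimes> (z \<otimes> x)))
        = u \<otimes> ((z \<otimes> y) \<otimes> x) \<oplus> \<ominus> (u \<otimes> ((z \<otimes> x) \<otimes> y)) \<oplus> \<ominus> (u \<otimes> (y \<otimes> (z \<otimes> x)))"
        using c u by (simp add: mult_add mult_minus)
      also have "u \<otimes> (y \<otimes> (z \<otimes> x)) = \<ominus> (u \<otimes> ((z \<otimes> x) \<otimes> y))" by (rule s) (use c in auto)
      finally show ?thesis using c u by (simp add: M.a_assoc M.l_neg)
    qed
    then show ?thesis by (auto simp: right_mult_def)
  qed
  have "leibniz_algebra K ?Q"
  proof unfold_locales
    fix X Y Z assume "X \<in> carrier ?Q" "Y \<in> carrier ?Q" "Z \<in> carrier ?Q"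
    then obtain x y z where c: "x \<in> carrier L" "y \<in> carrier L" "z \<in> carrier L"
      and X: "X = ?f x" "Y = ?f y" "Z = ?f z" unfolding car by blast
    show "X \<otimes>\<^bsub>?Q\<^esub> (Y \<otimes>\<^bsub>?Q\<^esub> Z)
      = X \<otimes>\<^bsub>?Q\<^esub> Y \<otimes>\<^bsub>?Q\<^esub> Z \<ominus>\<^bsub>?Q\<^esub> X \<otimes>\<^bsub>?Q\<^esub> Z \<otimes>\<^bsub>?Q\<^esub> Y"
      unfolding X Q.M.minus_eq
      using c rel[OF c] by (simp only: mult add minus mult_closed M.a_inv_closed)
  qed
  then show ?thesis by (rule leibniz_algebra.lie_algebraI) (rule alt)
qed

end

end

theory Submission
  imports Defs
begin

text \<open>
  The map \<open>x + I \<mapsto> R\<^bsub>-x\<^esub>\<close> is a well-defined surjective homomorphism of Lie algebras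
  from \<open>L / I\<close> to \<open>R(L)\<close>; the sign compensates the reversal
  \<open>[R\<^bsub>x\<^esub>, R\<^bsub>y\<^esub>] = R\<^bsub>[y, x]\<^esub>\<close>.  It intertwines the adjoint representations, so the
  components of \<open>ad x\<close> on \<open>L / I\<close> induce those of the adjoint action on \<open>R(L)\<close>:
  complete reducibility, nilpotency and commutation all pass to quotients.
\<close>

section \<open>Jordan decompositions of adjoint maps under surjective homomorphisms\<close>

locale nonassoc_algebra_hom =
  A?: nonassoc_algebra K A + B?: nonassoc_algebra K B
  for K (structure) and A (structure) and B (structure) and \<phi> +
  assumes hom_closed: "x \<in> carrier A \<Longrightarrow> \<phi> x \<in> carrier B"
    and hom_add: "\<lbrakk>x \<in> carrier A; y \<in> carrier A\<rbrakk> \<Longrightarrow> \<phi> (x \<oplus>\<^bsub>A\<^esub> y) = \<phi> x \<oplus>\<^bsub>B\<^esub> \<phi> y"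
    and hom_mult: "\<lbrakk>x \<in> carrier A; y \<in> carrier A\<rbrakk> \<Longrightarrow> \<phi> (x \<otimes>\<^bsub>A\<^esub> y) = \<phi> x \<otimes>\<^bsub>B\<^esub> \<phi> y"
    and hom_smult: "\<lbrakk>a \<in> carrier K; x \<in> carrier A\<rbrakk> \<Longrightarrow> \<phi> (a \<odot>\<^bsub>A\<^esub> x) = a \<odot>\<^bsub>B\<^esub> \<phi> x"

lemma (in nonassoc_algebra) ad_in_lin_endos: "x \<in> carrier L \<Longrightarrow> ad L x \<in> lin_endos K L"
  by (auto simp: ad_def lin_endos_def mult_add mult_smult)

lemma (in nonassoc_algebra) ad_closed:
  "x \<in> carrier L \<Longrightarrow> y \<in> carrier L \<Longrightarrow> ad L x y \<in> carrier L"
  by (simp add: ad_def)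

context nonassoc_algebra_hom
begin

lemma hom_zero: "\<phi> \<zero>\<^bsub>A\<^esub> = \<zero>\<^bsub>B\<^esub>"
  using hom_smult[of "\<zero>\<^bsub>K\<^esub>" "\<zero>\<^bsub>A\<^esub>"] hom_closed[of "\<zero>\<^bsub>A\<^esub>"] by simp

lemma hom_minus: "x \<in> carrier A \<Longrightarrow> \<phi> (\<ominus>\<^bsub>A\<^esub> x) = \<ominus>\<^bsub>B\<^esub> \<phi> x"
  by (simp add: A.minus_conv_smult B.minus_conv_smult hom_smult hom_closed)

lemma hom_ad: "x \<in> carrier A \<Longrightarrow> y \<in> carrier A \<Longrightarrow> \<phi> (ad A x y) = ad B (\<phi> x) (\<phi> y)"
  by (simp add: ad_def hom_mult hom_closed)

text \<open>Serves to pull a subspace of \<open>B\<close> back to \<open>A\<close>, where complete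
  reducibility is available.\<close>

lemma vimage_submodule:
  assumes "submodule W K B"
  shows "submodule {x \<in> carrier A. \<phi> x \<in> W} K A"
proof (rule A.submoduleI)
  note W = B.submoduleE[OF assms]
  let ?V = "{x \<in> carrier A. \<phi> x \<in> W}"
  show "?V \<subseteq> carrier A" by blast
  show "\<zero>\<^bsub>A\<^esub> \<in> ?V"
    using subgroup.one_closed[OF submodule.axioms(1)[OF assms]] by (simp add: hom_zero)
  show "\<ominus>\<^bsub>A\<^esub> a \<in> ?V" if "a \<in> ?V" for a
    using that W(3) by (simp add: hom_minus)
  show "a \<oplus>\<^bsub>A\<^esub> b \<in> ?V" if "a \<in> ?V" "b \<in> ?V" for a b
    using that W(5) by (simp add: hom_add)
  show "a \<odot>\<^bsub>A\<^esub> x \<in> ?V" if "a \<in> carrier K" "x \<in> ?V" for a x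
    using that W(4) by (simp add: hom_smult)
qed

text \<open>Serves to push a complement found in \<open>A\<close> forward to
  \<open>B\<close>.\<close>

lemma image_submodule:
  assumes "submodule U K A"
  shows "submodule (\<phi> ` U) K B"
proof (rule B.submoduleI)
  note U = A.submoduleE[OF assms]
  have c: "u \<in> U \<Longrightarrow> u \<in> carrier A" for u using U(1) by blast
  show "\<phi> ` U \<subseteq> carrier B" using c hom_closed by blast
  have "\<zero>\<^bsub>A\<^esub> \<in> U"
    using subgroup.one_closed[OF submodule.axioms(1)[OF assms]] by simp
  then have "\<phi> \<zero>\<^bsub>A\<^esub> \<in> \<phi> ` U" by (rule imageI)
  then show "\<zero>\<^bsub>B\<^esub> \<in> \<phi> ` U" by (simp only: hom_zero)
  show "\<ominus>\<^bsub>B\<^esub> a \<in> \<phi> ` U" if a: "a \<in> \<phi> ` U" for a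
  proof -
    obtain u where "u \<in> U" "a = \<phi> u" using a by blast
    then show ?thesis using imageI[OF U(3)[of u], of \<phi>] c by (simp add: hom_minus)
  qed
  show "a \<oplus>\<^bsub>B\<^esub> b \<in> \<phi> ` U" if ab: "a \<in> \<phi> ` U" "b \<in> \<phi> ` U" for a b
  proof -
    obtain u v where "u \<in> U" "a = \<phi> u" "v \<in> U" "b = \<phi> v" using ab by blast
    then show ?thesis using imageI[OF U(5)[of u v], of \<phi>] c by (simp add: hom_add)
  qed
  show "a \<odot>\<^bsub>B\<^esub> x \<in> \<phi> ` U" if a: "a \<in> carrier K" and x: "x \<in> \<phi> ` U" for a x
  proof -
    obtain u where "u \<in> U" "x = \<phi> u" using x by blast
    then show ?thesis using imageI[OF U(4)[of a u], of \<phi>] a c by (simp add: hom_smult)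
  qed
qed

text \<open>The map \<open>\<phi>\<close> intertwines the powers of the two adjoint maps, so an
  exponent that kills \<open>A\<close> also kills \<open>B\<close>, every element of
  \<open>B\<close> being some \<open>\<phi> x\<close>.\<close>

lemma nilpotent_endo_ad_hom:
  assumes surj: "\<phi> ` carrier A = carrier B"
    and n: "n \<in> carrier A" and nil: "nilpotent_endo K A (ad A n)"
  shows "nilpotent_endo K B (ad B (\<phi> n))"
proof -
  obtain k where k: "\<And>x. x \<in> carrier A \<Longrightarrow> (ad A n ^^ k) x = \<zero>\<^bsub>A\<^esub>"
    using nil by (auto simp: nilpotent_endo_def)
  \<comment> \<open>Membership in \<open>A\<close> is carried along in the induction because
    \<open>hom_ad\<close> applies only to elements of the carrier.\<close>
  have "(ad A n ^^ j) x \<in> carrier A \<and> \<phi> ((ad A n ^^ j) x) = (ad B (\<phi> n) ^^ j) (\<phi> x)"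
    if "x \<in> carrier A" for j x
    by (induction j) (use that n in \<open>simp_all add: hom_ad A.ad_closed\<close>)
  then have "(ad B (\<phi> n) ^^ k) (\<phi> x) = \<zero>\<^bsub>B\<^esub>" if "x \<in> carrier A" for x
    using that k hom_zero by metis
  then show ?thesis
    unfolding nilpotent_endo_def surj[symmetric]
    using B.ad_in_lin_endos[OF hom_closed[OF n]] by blast
qed

text \<open>Complete reducibility passes to a quotient: an invariant subspace of \<open>B\<close> is
  pulled back to \<open>A\<close>, complemented there, and the image of the complement is a
  complement in \<open>B\<close>.\<close>

lemma semisimple_endo_ad_hom:
  assumes surj: "\<phi> ` carrier A = carrier B"
    and s: "s \<in> carrier A" and ss: "semisimple_endo K A (ad A s)"
  shows "semisimple_endo K B (ad B (\<phi> s))"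
  unfolding semisimple_endo_def
proof (intro conjI allI impI)
  show "ad B (\<phi> s) \<in> lin_endos K B" by (rule B.ad_in_lin_endos[OF hom_closed[OF s]])
  fix W assume "invariant_subspace K B (ad B (\<phi> s)) W"
  then have W: "submodule W K B" and inv: "ad B (\<phi> s) ` W \<subseteq> W"
    by (auto simp: invariant_subspace_def)
  \<comment> \<open>The full preimage of \<open>W\<close> contains the kernel of
    \<open>\<phi>\<close>. A complement \<open>U\<close> of \<open>V\<close> therefore meets the
    kernel only in zero, and an element of \<open>U\<close> mapped into \<open>W\<close> already
    lies in \<open>V\<close>, hence vanishes.\<close>
  define V where "V = {x \<in> carrier A. \<phi> x \<in> W}"
  have "ad A s x \<in> V" if "x \<in> V" for x
    using that inv s hom_ad[OF s, of x] by (auto simp: V_def ad_def)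
  then have "invariant_subspace K A (ad A s) V"
    using vimage_submodule[OF W] by (auto simp: invariant_subspace_def V_def)
  then obtain U where U: "submodule U K A" and Uinv: "ad A s ` U \<subseteq> U"
    and VU0: "V \<inter> U = {\<zero>\<^bsub>A\<^esub>}" and VU: "V <+>\<^bsub>A\<^esub> U = carrier A"
    using ss unfolding semisimple_endo_def invariant_subspace_def by blast
  have Uc: "U \<subseteq> carrier A" by (rule A.submoduleE(1)[OF U])
  show "\<exists>U. invariant_subspace K B (ad B (\<phi> s)) U \<and> W \<inter> U = {\<zero>\<^bsub>B\<^esub>} \<and> W <+>\<^bsub>B\<^esub> U = carrier B"
  proof (intro exI[of _ "\<phi> ` U"] conjI)
    have "ad B (\<phi> s) (\<phi> u) \<in> \<phi> ` U" if "u \<in> U" for u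
      using that Uinv Uc hom_ad[OF s, of u] by (metis image_eqI image_subset_iff subsetD)
    then show "invariant_subspace K B (ad B (\<phi> s)) (\<phi> ` U)"
      using image_submodule[OF U] by (auto simp: invariant_subspace_def)
    have "\<zero>\<^bsub>A\<^esub> \<in> V \<inter> U" using VU0 by simp
    then have "\<zero>\<^bsub>B\<^esub> \<in> W \<inter> \<phi> ` U" using hom_zero by (force simp: V_def)
    moreover have "\<phi> u = \<zero>\<^bsub>B\<^esub>" if "u \<in> U" "\<phi> u \<in> W" for u
    proof -
      have "u \<in> V \<inter> U" using that Uc by (auto simp: V_def)
      then show ?thesis using VU0 hom_zero by simp
    qed
    ultimately show "W \<inter> \<phi> ` U = {\<zero>\<^bsub>B\<^esub>}" by blast
    show "W <+>\<^bsub>B\<^esub> \<phi> ` U = carrier B"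
    proof
      show "W <+>\<^bsub>B\<^esub> \<phi> ` U \<subseteq> carrier B"
        using B.submoduleE(1)[OF W] Uc hom_closed by (force simp: set_add_def')
      show "carrier B \<subseteq> W <+>\<^bsub>B\<^esub> \<phi> ` U"
      proof
        fix y assume "y \<in> carrier B"
        then obtain x where x: "x \<in> carrier A" "y = \<phi> x" using surj by blast
        \<comment> \<open>Surjectivity turns the decomposition of a preimage \<open>x\<close> into
          one of \<open>y\<close>, since \<open>\<phi> v\<close> lies in \<open>W\<close>.\<close>
        then obtain v u where "v \<in> V" "u \<in> U" "x = v \<oplus>\<^bsub>A\<^esub> u"
          unfolding VU[symmetric] set_add_def' by blast
        then show "y \<in> W <+>\<^bsub>B\<^esub> \<phi> ` U"
          using x(2) Uc hom_add[of v u] by (auto simp: V_def set_add_def')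
      qed
    qed
  qed
qed

text \<open>If \<open>ad s\<close> and \<open>ad n\<close> are the components of \<open>ad x\<close>
  in \<open>A\<close>, then the adjoint maps of \<open>\<phi> s\<close> and \<open>\<phi> n\<close>
  are components of that of \<open>\<phi> x\<close>. They are inner by construction, and
  surjectivity ensures that every inner map of \<open>B\<close> comes from such an
  \<open>x\<close>.\<close>

theorem almost_algebraic_lie_hom:
  assumes surj: "\<phi> ` carrier A = carrier B" and aa: "almost_algebraic_lie K A"
  shows "almost_algebraic_lie K B"
  unfolding almost_algebraic_lie_def almost_algebraic_linear_def
proof
  fix T assume "T \<in> ad B ` carrier B"
  then obtain x where x: "x \<in> carrier A" "T = ad B (\<phi> x)"
    unfolding surj[symmetric] by blast
  from imageI[OF x(1), of "ad A"] have "\<exists>S N. jordan_decomposition K A (ad A x) S N \<and>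
      S \<in> ad A ` carrier A \<and> N \<in> ad A ` carrier A"
    using aa unfolding almost_algebraic_lie_def almost_algebraic_linear_def by (rule bspec[rotated])
  then obtain s n where s: "s \<in> carrier A" and n: "n \<in> carrier A"
    and j: "jordan_decomposition K A (ad A x) (ad A s) (ad A n)"
    by (elim exE conjE imageE) (simp only:)
  \<comment> \<open>The decomposition determines \<open>s\<close> and \<open>n\<close> only modulo
    the kernel of \<open>ad\<close>, so \<open>x\<close> itself need not be the sum of
    \<open>s\<close> and \<open>n\<close>. What is transported to \<open>B\<close> is the identity
    between products with an arbitrary \<open>y\<close>.\<close>
  have sum: "x \<otimes>\<^bsub>A\<^esub> y = s \<otimes>\<^bsub>A\<^esub> y \<oplus>\<^bsub>A\<^esub> n \<otimes>\<^bsub>A\<^esub> y" if "y \<in> carrier A" for y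
  proof -
    have "ad A x y = (ad A s \<oplus>\<^bsub>gl K A\<^esub> ad A n) y"
      using j unfolding jordan_decomposition_def by metis
    then show ?thesis using that by (simp add: ad_def gl_def)
  qed
  have comm: "s \<otimes>\<^bsub>A\<^esub> (n \<otimes>\<^bsub>A\<^esub> y) = n \<otimes>\<^bsub>A\<^esub> (s \<otimes>\<^bsub>A\<^esub> y)" if "y \<in> carrier A" for y
  proof -
    have "ad A s (ad A n y) = ad A n (ad A s y)"
      using j that unfolding jordan_decomposition_def by blast
    then show ?thesis using that s n by (simp add: ad_def)
  qed
  have sum': "\<phi> x \<otimes>\<^bsub>B\<^esub> y = \<phi> s \<otimes>\<^bsub>B\<^esub> y \<oplus>\<^bsub>B\<^esub> \<phi> n \<otimes>\<^bsub>B\<^esub> y" if "y \<in> carrier B" for y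
  proof -
    obtain z where z: "z \<in> carrier A" "y = \<phi> z"
      using \<open>y \<in> carrier B\<close> unfolding surj[symmetric] by (rule imageE)
    have "\<phi> (x \<otimes>\<^bsub>A\<^esub> z) = \<phi> (s \<otimes>\<^bsub>A\<^esub> z \<oplus>\<^bsub>A\<^esub> n \<otimes>\<^bsub>A\<^esub> z)"
      by (simp only: sum[OF z(1)])
    then show ?thesis by (simp only: z x(1) s n hom_mult hom_add A.mult_closed)
  qed
  have comm': "\<phi> s \<otimes>\<^bsub>B\<^esub> (\<phi> n \<otimes>\<^bsub>B\<^esub> y) = \<phi> n \<otimes>\<^bsub>B\<^esub> (\<phi> s \<otimes>\<^bsub>B\<^esub> y)" if "y \<in> carrier B" for y
  proof -
    obtain z where z: "z \<in> carrier A" "y = \<phi> z"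
      using \<open>y \<in> carrier B\<close> unfolding surj[symmetric] by (rule imageE)
    have "\<phi> (s \<otimes>\<^bsub>A\<^esub> (n \<otimes>\<^bsub>A\<^esub> z)) = \<phi> (n \<otimes>\<^bsub>A\<^esub> (s \<otimes>\<^bsub>A\<^esub> z))"
      by (simp only: comm[OF z(1)])
    then show ?thesis by (simp only: z s n hom_mult A.mult_closed)
  qed
  have "jordan_decomposition K B T (ad B (\<phi> s)) (ad B (\<phi> n))"
    unfolding jordan_decomposition_def
  proof (intro conjI ballI)
    show "semisimple_endo K B (ad B (\<phi> s))" "nilpotent_endo K B (ad B (\<phi> n))"
      using semisimple_endo_ad_hom[OF surj s] nilpotent_endo_ad_hom[OF surj n] j
      unfolding jordan_decomposition_def by blast+
    show "T = ad B (\<phi> s) \<oplus>\<^bsub>gl K B\<^esub> ad B (\<phi> n)"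
      by (auto simp: x(2) gl_def ad_def sum')
    show "ad B (\<phi> s) (ad B (\<phi> n) y) = ad B (\<phi> n) (ad B (\<phi> s) y)" if "y \<in> carrier B" for y
      using that comm'[OF that] hom_closed[OF s] hom_closed[OF n] by (simp add: ad_def)
  qed
  then show "\<exists>S N. jordan_decomposition K B T S N \<and> S \<in> ad B ` carrier B \<and> N \<in> ad B ` carrier B"
    using s n hom_closed by blast
qed

end

section \<open>The homomorphism from \<open>L / I\<close> onto \<open>R(L)\<close>\<close>

context leibniz_algebra
begin

text \<open>Exchanging \<open>x\<close> and \<open>y\<close> in the Leibniz identity swaps its two
  terms. Hence the bracket becomes anticommutative once it acts by right multiplication.\<close>

lemma mult_anticomm:
  assumes "x \<in> carrier L" "y \<in> carrier L" "z \<in> carrier L"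
  shows "z \<otimes> (x \<otimes> y) = \<ominus> (z \<otimes> (y \<otimes> x))"
  using assms by (simp add: leibniz_identity M.minus_eq M.minus_add M.a_ac)

lemma inner_derivations_simps:
  "carrier (inner_derivations K L) = right_mult L ` carrier L"
  "\<lbrakk>x \<in> carrier L; y \<in> carrier L\<rbrakk> \<Longrightarrow>
    right_mult L x \<oplus>\<^bsub>inner_derivations K L\<^esub> right_mult L y = right_mult L (x \<oplus> y)"
  "\<lbrakk>x \<in> carrier L; y \<in> carrier L\<rbrakk> \<Longrightarrow>
    right_mult L x \<otimes>\<^bsub>inner_derivations K L\<^esub> right_mult L y = right_mult L (y \<otimes> x)"
  "\<lbrakk>a \<in> carrier K; x \<in> carrier L\<rbrakk> \<Longrightarrow>
    a \<odot>\<^bsub>inner_derivations K L\<^esub> right_mult L x = right_mult L (a \<odot> x)"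
  using bracket_right_mult[of x y]
  by (auto simp: inner_derivations_def gl_def right_mult_def mult_add mult_smult fun_eq_iff)

text \<open>Right multiplication by an element of the Leibniz kernel is zero, so
  \<open>x \<mapsto> R_(-x)\<close> is constant on the cosets of \<open>I\<close> and descends to
  \<open>L / I\<close>.\<close>

lemma quot_to_inner_derivations:
  obtains \<phi> where
    "nonassoc_algebra_hom K (quot_algebra L (leibniz_kernel K L)) (inner_derivations K L) \<phi>"
    "\<phi> ` carrier (quot_algebra L (leibniz_kernel K L)) = carrier (inner_derivations K L)"
proof
  let ?I = "leibniz_kernel K L"
  let ?Q = "quot_algebra L ?I"
  let ?R = "inner_derivations K L"
  define \<psi> where "\<psi> x = right_mult L (\<ominus> x)" for x
  \<comment> \<open>The image of a coset under \<open>\<psi>\<close> is a singleton, by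
    \<open>\<psi>_coset\<close> below; \<open>the_elem\<close> extracts its value without choosing a
    representative.\<close>
  define \<phi> where "\<phi> C = the_elem (\<psi> ` C)" for C
  interpret Q: lie_algebra K ?Q by (rule lie_algebra_quot)
  interpret R: lie_algebra K ?R by (rule lie_algebra_inner_derivations)
  have Ic: "i \<in> carrier L" if "i \<in> ?I" for i
    using that submoduleE(1)[OF leibniz_kernel_submodule] by blast
  have I0: "\<zero> \<in> ?I" using square_in_leibniz_kernel[of \<zero>] by simp
  have \<psi>_closed: "\<psi> x \<in> carrier ?R" if "x \<in> carrier L" for x
    using that by (simp add: \<psi>_def inner_derivations_simps)
  have \<psi>_add: "\<psi> (x \<oplus> y) = \<psi> x \<oplus>\<^bsub>?R\<^esub> \<psi> y" if "x \<in> carrier L" "y \<in> carrier L" for x y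
    using that by (simp add: \<psi>_def inner_derivations_simps M.minus_add)
  \<comment> \<open>The two signs cancel in the bracket, which gives right multiplication by
    \<open>y \<otimes> x\<close>. By \<open>mult_anticomm\<close> this is the negative of right
    multiplication by \<open>x \<otimes> y\<close>, hence
    \<open>\<psi> (x \<otimes> y)\<close>.\<close>
  have \<psi>_mult: "\<psi> (x \<otimes> y) = \<psi> x \<otimes>\<^bsub>?R\<^esub> \<psi> y" if "x \<in> carrier L" "y \<in> carrier L" for x y
  proof -
    have "\<psi> x \<otimes>\<^bsub>?R\<^esub> \<psi> y = right_mult L (y \<otimes> x)"
      using that by (simp add: \<psi>_def inner_derivations_simps mult_minus minus_mult)
    also have "\<dots> = \<psi> (x \<otimes> y)"
      using that mult_anticomm[of y x] by (auto simp: \<psi>_def right_mult_def mult_minus)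
    finally show ?thesis by simp
  qed
  have \<psi>_smult: "\<psi> (a \<odot> x) = a \<odot>\<^bsub>?R\<^esub> \<psi> x" if "a \<in> carrier K" "x \<in> carrier L" for a x
    using that by (simp add: \<psi>_def inner_derivations_simps smult_r_minus)
  have \<psi>_ker: "\<psi> (i \<oplus> x) = \<psi> x" if "i \<in> ?I" "x \<in> carrier L" for i x
    using that Ic mult_leibniz_kernel[of _ i]
    by (auto simp: \<psi>_def right_mult_def M.minus_add mult_add mult_minus)
  have coset: "y \<in> ?I +> x \<longleftrightarrow> (\<exists>i\<in>?I. y = i \<oplus> x)" for x y
    by (auto simp: a_r_coset_def r_coset_def)
  have car: "carrier ?Q = (\<lambda>x. ?I +> x) ` carrier L"
    by (auto simp: quot_algebra_def A_RCOSETS_defs a_r_coset_def r_coset_def)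
  have self: "x \<in> ?I +> x" if "x \<in> carrier L" for x
    using that I0 by (auto simp: coset intro!: bexI[of _ \<zero>])
  have \<psi>_coset: "\<psi> ` (?I +> x) = {\<psi> x}" if "x \<in> carrier L" for x
  proof -
    have "\<psi> y = \<psi> x" if "y \<in> ?I +> x" for y
      using that \<open>x \<in> carrier L\<close> \<psi>_ker by (auto simp: coset)
    then show ?thesis using self[OF that] by blast
  qed
  \<comment> \<open>Any representative may be used to evaluate \<open>\<phi>\<close>. Each
    homomorphism law thus reduces to the law for \<open>\<psi>\<close> and to naming one element of
    the resulting coset.\<close>
  have \<phi>_eq: "\<phi> C = \<psi> x" if C: "C \<in> carrier ?Q" and x: "x \<in> C" for C x
  proof -
    obtain z where "z \<in> carrier L" "C = ?I +> z" using C car by blast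
    then have "\<psi> ` C = {\<psi> z}" using \<psi>_coset by blast
    moreover from this have "\<psi> x = \<psi> z" using x by blast
    ultimately show ?thesis by (simp add: \<phi>_def)
  qed
  have rep: "\<exists>x. x \<in> C \<and> x \<in> carrier L" if "C \<in> carrier ?Q" for C
    using that self car by auto
  have add: "x \<oplus> y \<in> C \<oplus>\<^bsub>?Q\<^esub> D" if "x \<in> C" "y \<in> D" for x y C D
    using that by (auto simp: quot_algebra_def set_add_def')
  \<comment> \<open>The product in the quotient is a union of cosets over all pairs of
    representatives; the coset belonging to the pair \<open>x\<close>, \<open>y\<close> contains
    \<open>x \<otimes> y\<close>. The scalar case below is analogous.\<close>
  have mult: "x \<otimes> y \<in> C \<otimes>\<^bsub>?Q\<^esub> D"
    if "x \<in> C" "y \<in> D" "x \<in> carrier L" "y \<in> carrier L" for x y C D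
    using that self[of "x \<otimes> y"] by (auto simp: quot_algebra_def rcoset_mult_def)
  have smult: "a \<odot> x \<in> a \<odot>\<^bsub>?Q\<^esub> C" if "x \<in> C" "x \<in> carrier L" "a \<in> carrier K" for a x C
    using that self[of "a \<odot> x"] by (auto simp: quot_algebra_def)
  show "nonassoc_algebra_hom K ?Q ?R \<phi>"
  proof unfold_locales
    fix C assume C: "C \<in> carrier ?Q"
    then obtain x where x: "x \<in> C" "x \<in> carrier L" using rep by blast
    show "\<phi> C \<in> carrier ?R" using \<phi>_eq[OF C x(1)] \<psi>_closed x by simp
    show "\<phi> (a \<odot>\<^bsub>?Q\<^esub> C) = a \<odot>\<^bsub>?R\<^esub> \<phi> C" if a: "a \<in> carrier K" for a
      using \<phi>_eq[OF Q.smult_closed[OF a C] smult[OF x a]] \<phi>_eq[OF C x(1)] \<psi>_smult[OF a x(2)]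
      by simp
    fix D assume D: "D \<in> carrier ?Q"
    then obtain y where y: "y \<in> D" "y \<in> carrier L" using rep by blast
    show "\<phi> (C \<oplus>\<^bsub>?Q\<^esub> D) = \<phi> C \<oplus>\<^bsub>?R\<^esub> \<phi> D"
      using \<phi>_eq[OF Q.M.add.m_closed[OF C D] add[OF x(1) y(1)]] \<phi>_eq[OF C x(1)] \<phi>_eq[OF D y(1)]
        \<psi>_add[OF x(2) y(2)] by simp
    show "\<phi> (C \<otimes>\<^bsub>?Q\<^esub> D) = \<phi> C \<otimes>\<^bsub>?R\<^esub> \<phi> D"
      using \<phi>_eq[OF Q.mult_closed[OF C D] mult[OF x(1) y(1) x(2) y(2)]] \<phi>_eq[OF C x(1)]
        \<phi>_eq[OF D y(1)] \<psi>_mult[OF x(2) y(2)] by simp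
  qed
  have "\<phi> ` carrier ?Q = \<psi> ` carrier L"
    unfolding car image_image using \<psi>_coset by (intro image_cong) (auto simp: \<phi>_def)
  also have "\<dots> = right_mult L ` carrier L"
  proof
    show "right_mult L ` carrier L \<subseteq> \<psi> ` carrier L"
    proof
      fix T assume "T \<in> right_mult L ` carrier L"
      \<comment> \<open>Negation permutes the carrier, so the sign in \<open>\<psi>\<close> does not
        change its range: the witness is the negative of the given element.\<close>
      then obtain x where "x \<in> carrier L" "T = \<psi> (\<ominus> x)" by (auto simp: \<psi>_def)
      then show "T \<in> \<psi> ` carrier L" by blast
    qed
  qed (auto simp: \<psi>_def)
  finally show "\<phi> ` carrier ?Q = carrier ?R" by (simp add: inner_derivations_simps)
qed

end

theorem proposition3p6:
  fixes K :: "('a, 'm) ring_scheme" and L :: "('a, 'b, 'n) module_scheme"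
  assumes "leibniz_algebra K L"
    and "char_zero K"
    and "fin_dim K L"
    and "almost_algebraic_leibniz K L"
  shows "almost_algebraic_lie K (inner_derivations K L)"
proof -
  interpret leibniz_algebra K L by fact
  obtain \<phi> where
    "nonassoc_algebra_hom K (quot_algebra L (leibniz_kernel K L)) (inner_derivations K L) \<phi>"
    "\<phi> ` carrier (quot_algebra L (leibniz_kernel K L)) = carrier (inner_derivations K L)"
    by (rule quot_to_inner_derivations)
  \<comment> \<open>By definition, \<open>L\<close> being almost algebraic is a statement about
    \<open>L / I\<close>, the source of the surjection \<open>\<phi>\<close>.\<close>
  then show ?thesis
    using assms(4) unfolding almost_algebraic_leibniz_def
    by (rule nonassoc_algebra_hom.almost_algebraic_lie_hom)
qed

end
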